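(* Let $q$ and $m$ be positive integers ($m\ge 2$) composed of the same primes, such that the exponent of each prime in $q$ is strictly greater than its exponent in $m$. Let $A\subseteq \mathbb{Z}_q$ be a digital set with $|A|=m$. Let $p^\alpha$ ($p$ prime, $\alpha\ge 1$) be the largest prime power dividing $m$, and let $\delta_m=1$ if $m$ is odd and $\delta_m=0$ if $m$ is even. Then $$C_2(A)\ \ge\ \mu(m),\qquad \text{where}\quad \mu(m)=\begin{cases}\dfrac{1-1/p^{2\alpha}-2/p^{\alpha}+2\delta_m/m}{4} & \text{if } p \text{ is odd},\\[2mm] \dfrac14 & \text{if } p=2.\end{cases}$$ In particular, $$\lim_{m\to+\infty}\ \min_{|A|=m} C_2(A)=\frac14,$$ where, for each $m \ge 2$, the minimum is over all digital sets $A\subseteq\mathbb{Z}_q$ with $|A|=m$, with $q$ ranging over the positive integers composed of the same primes as $m$ and such that the exponent of each prime in $q$ is strictly greater than its exponent in $m$.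
   Context: $\mathbb{Z}_q=\mathbb{Z}/q\mathbb{Z}$. For $m\mid q$, a digital set of cardinality $m$ in $\mathbb{Z}_q$ is a set $A\subseteq\mathbb{Z}_q$ with $|A|=m$ which is a complete set of coset representatives for the subgroup $m\mathbb{Z}_q$ (equivalently, reduction modulo $m$ maps $A$ bijectively onto $\mathbb{Z}_m$). The frequency of carries of $A$ is $$C_2(A)=\frac{|\{(a_1,a_2)\in A\times A:\ a_1+a_2\notin A\}|}{|A|^2},$$ with addition in $\mathbb{Z}_q$. *)

theory Defs
  imports Complex_Main "HOL-Number_Theory.Number_Theory"
begin

abbreviation Zmod :: "nat \<Rightarrow> int ring" where
  "Zmod q \<equiv> residue_ring (int q)"

text \<open>The subgroup \<open>m Z_q\<close> of the additive group of \<open>Z_q\<close>.\<close>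

definition multiples_in :: "nat \<Rightarrow> nat \<Rightarrow> int set" where
  "multiples_in q m = (\<lambda>x. [m] \<cdot>\<^bsub>Zmod q\<^esub> x) ` carrier (Zmod q)"

text \<open>Intended for \<open>m dvd q\<close>; see \<open>digital_set_iff_bij_betw\<close> below for the reformulation through
  reduction modulo \<open>m\<close>.\<close>

definition digital_set :: "nat \<Rightarrow> nat \<Rightarrow> int set \<Rightarrow> bool" where
  "digital_set q m A \<longleftrightarrow>
     A \<subseteq> carrier (Zmod q) \<and> card A = m \<and>
     (\<forall>C \<in> a_rcosets\<^bsub>Zmod q\<^esub> (multiples_in q m). \<exists>!a. a \<in> A \<inter> C)"

definition carry_freq :: "nat \<Rightarrow> int set \<Rightarrow> real" where
  "carry_freq q A =
     real (card {(a1, a2). a1 \<in> A \<and> a2 \<in> A \<and> a1 \<oplus>\<^bsub>Zmod q\<^esub> a2 \<notin> A}) / (real (card A))\<^sup>2"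

definition admissible_modulus :: "nat \<Rightarrow> nat \<Rightarrow> bool" where
  "admissible_modulus m q \<longleftrightarrow>
     q > 0 \<and> prime_factors q = prime_factors m \<and>
     (\<forall>p \<in> prime_factors m. multiplicity p m < multiplicity p q)"

definition carry_freqs :: "nat \<Rightarrow> real set" where
  "carry_freqs m = {carry_freq q A | q A. admissible_modulus m q \<and> digital_set q m A}"

text \<open>For \<open>m \<ge> 2\<close> the minimum is over a finite nonempty set, as shown by \<open>finite_carry_freqs\<close> and
  \<open>carry_freqs_nonempty\<close> below.\<close>

definition min_carry_freq :: "nat \<Rightarrow> real" where
  "min_carry_freq m = Min (carry_freqs m)"


lemma add_pow_residue_ring:
  assumes "0 < q"
  shows "[(n::nat)] \<cdot>\<^bsub>Zmod q\<^esub> x = (int n * x) mod int q"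
proof (induction n)
  case 0
  then show ?case by (simp add: add_pow_def nat_pow_def residue_ring_def)
next
  case (Suc n)
  then show ?case
    by (simp add: add_pow_def nat_pow_def residue_ring_def algebra_simps mod_simps)
qed

lemma coset_multiples_in:
  assumes "0 < q" "m dvd q" "x \<in> carrier (Zmod q)"
  shows "multiples_in q m +>\<^bsub>Zmod q\<^esub> x = {y \<in> carrier (Zmod q). y mod int m = x mod int m}"
proof -
  have "0 < m" using assms(1,2) by (auto intro!: Nat.gr0I)
  have dvd: "int m dvd int q" using assms(2) by simp
  have carr: "carrier (Zmod q) = {0..<int q}" by (auto simp: residue_ring_def)
  have mult: "multiples_in q m = (\<lambda>x. (int m * x) mod int q) ` {0..<int q}"
    unfolding multiples_in_def carr add_pow_residue_ring[OF assms(1)] ..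
  have coset0: "multiples_in q m +>\<^bsub>Zmod q\<^esub> x = (\<lambda>h. (h + x) mod int q) ` multiples_in q m"
    by (auto simp: a_r_coset_def r_coset_def residue_ring_def)
  have coset: "multiples_in q m +>\<^bsub>Zmod q\<^esub> x =
      (\<lambda>k. ((int m * k) mod int q + x) mod int q) ` {0..<int q}"
    unfolding coset0 by (simp only: mult image_image)
  show ?thesis
  proof (intro equalityI subsetI)
    fix y assume "y \<in> multiples_in q m +>\<^bsub>Zmod q\<^esub> x"
    then obtain k where "y = ((int m * k) mod int q + x) mod int q"
      unfolding coset by (elim imageE)
    then have y: "y = (int m * k + x) mod int q" by (simp add: mod_simps)
    then have "y mod int m = x mod int m"
      using dvd by (simp add: mod_mod_cancel)
    then show "y \<in> {y \<in> carrier (Zmod q). y mod int m = x mod int m}"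
      using assms(1) y by (simp add: carr)
  next
    fix y assume "y \<in> {y \<in> carrier (Zmod q). y mod int m = x mod int m}"
    then have y: "0 \<le> y" "y < int q" and "y mod int m = x mod int m" by (auto simp: carr)
    then have "int m dvd y - x" by (simp add: mod_eq_dvd_iff)
    then obtain k where k: "y - x = int m * k" by (elim dvdE)
    have "((int m * (k mod int q)) mod int q + x) mod int q = (int m * k + x) mod int q"
      by (simp add: mod_simps)
    also have "int m * k + x = y" using k by simp
    also have "y mod int q = y" using y by simp
    finally have "y = ((int m * (k mod int q)) mod int q + x) mod int q" ..
    moreover have "k mod int q \<in> {0..<int q}" using assms(1) by simp
    ultimately show "y \<in> multiples_in q m +>\<^bsub>Zmod q\<^esub> x"
      unfolding coset[unfolded mult] mult by blast
  qed
qed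

lemma digital_set_iff_bij_betw:
  assumes "0 < q" "m dvd q"
  shows "digital_set q m A \<longleftrightarrow>
           A \<subseteq> {0..<int q} \<and> bij_betw (\<lambda>a. a mod int m) A {0..<int m}"
proof -
  have "0 < m" using assms by (auto intro!: Nat.gr0I)
  have mq: "m \<le> q" using assms by (simp add: dvd_imp_le)
  have carr: "carrier (Zmod q) = {0..<int q}" by (auto simp: residue_ring_def)
  have cosets: "(\<forall>C \<in> a_rcosets\<^bsub>Zmod q\<^esub> (multiples_in q m). \<exists>!a. a \<in> A \<inter> C) \<longleftrightarrow>
      (\<forall>x \<in> {0..<int q}. \<exists>!a. a \<in> A \<and> a mod int m = x mod int m)" (is "?L \<longleftrightarrow> ?R")
    if "A \<subseteq> {0..<int q}"
  proof -
    have "?L \<longleftrightarrow> (\<forall>x \<in> {0..<int q}. \<exists>!a. a \<in> A \<inter> {y \<in> {0..<int q}. y mod int m = x mod int m})"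
      using coset_multiples_in[OF assms] by (simp add: A_RCOSETS_def' carr)
    also have "\<dots> \<longleftrightarrow> ?R"
      using that by (intro ball_cong refl arg_cong[where f = Ex1] ext) auto
    finally show ?thesis .
  qed
  have "(card A = m \<and> (\<forall>x \<in> {0..<int q}. \<exists>!a. a \<in> A \<and> a mod int m = x mod int m)) \<longleftrightarrow>
        bij_betw (\<lambda>a. a mod int m) A {0..<int m}" if A: "A \<subseteq> {0..<int q}"
  proof
    assume *: "card A = m \<and> (\<forall>x \<in> {0..<int q}. \<exists>!a. a \<in> A \<and> a mod int m = x mod int m)"
    have "inj_on (\<lambda>a. a mod int m) A"
      using * A by (intro inj_onI) (metis subsetD)
    moreover have "(\<lambda>a. a mod int m) ` A = {0..<int m}"
    proof (intro equalityI subsetI)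
      fix x assume "x \<in> {0..<int m}"
      moreover from this have "x \<in> {0..<int q}" using mq by auto
      ultimately obtain a where "a \<in> A" "a mod int m = x" using * by fastforce
      then show "x \<in> (\<lambda>a. a mod int m) ` A" by blast
    qed (use \<open>0 < m\<close> in auto)
    ultimately show "bij_betw (\<lambda>a. a mod int m) A {0..<int m}" by (simp add: bij_betw_def)
  next
    assume *: "bij_betw (\<lambda>a. a mod int m) A {0..<int m}"
    have "\<exists>!a. a \<in> A \<and> a mod int m = x mod int m" for x
    proof -
      have "x mod int m \<in> (\<lambda>a. a mod int m) ` A"
        using * \<open>0 < m\<close> by (simp add: bij_betw_def)
      then obtain a where "a \<in> A" "a mod int m = x mod int m" by force
      then show ?thesis using * by (metis (mono_tags, lifting) bij_betw_def inj_onD)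
    qed
    moreover have "card A = m" using bij_betw_same_card[OF *] by simp
    ultimately show "card A = m \<and> (\<forall>x \<in> {0..<int q}. \<exists>!a. a \<in> A \<and> a mod int m = x mod int m)"
      by blast
  qed
  then show ?thesis
    unfolding digital_set_def carr using cosets by (cases "A \<subseteq> {0..<int q}") simp_all
qed

lemma finite_carry_freqs: "finite (carry_freqs m)"
proof (rule finite_subset)
  show "carry_freqs m \<subseteq> (\<lambda>k. real k / (real m)\<^sup>2) ` {..m\<^sup>2}"
  proof
    fix c assume "c \<in> carry_freqs m"
    then obtain q A where c: "c = carry_freq q A" and A: "A \<subseteq> carrier (Zmod q)" "card A = m"
      by (auto simp: carry_freqs_def digital_set_def)
    have fin: "finite A" using A(1) by (rule finite_subset) (simp add: residue_ring_def)
    have "card {(a1, a2). a1 \<in> A \<and> a2 \<in> A \<and> a1 \<oplus>\<^bsub>Zmod q\<^esub> a2 \<notin> A} \<le> card (A \<times> A)"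
      by (rule card_mono) (use fin in auto)
    also have "\<dots> = m\<^sup>2" by (simp add: card_cartesian_product A(2) power2_eq_square)
    finally show "c \<in> (\<lambda>k. real k / (real m)\<^sup>2) ` {..m\<^sup>2}"
      by (auto simp: c carry_freq_def A(2))
  qed
qed simp

lemma carry_freqs_nonempty:
  assumes "2 \<le> m"
  shows "carry_freqs m \<noteq> {}"
proof -
  have "admissible_modulus m (m\<^sup>2)"
    using assms
    by (auto simp: admissible_modulus_def prime_factors_power prime_elem_multiplicity_power_distrib
        prime_factors_multiplicity)
  moreover have "bij_betw (\<lambda>a. a mod int m) {0..<int m} {0..<int m}"
    by (rule bij_betw_cong[THEN iffD1, OF _ bij_betw_id]) simp
  then have "digital_set (m\<^sup>2) m {0..<int m}"
    using assms by (subst digital_set_iff_bij_betw) (auto simp: power2_eq_square intro: less_le_trans)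
  ultimately show ?thesis by (auto simp: carry_freqs_def)
qed

end

theory Submission
  imports Defs
begin

text \<open>
  For \<open>x\<close> in \<open>Z_q\<close> let the displacement \<open>d(x)\<close> be the number of \<open>a \<in> A\<close> with \<open>x + a \<notin> A\<close>.
  The number of carries is the sum of \<open>d(a)\<close> over \<open>a \<in> A\<close>, so the lower bound says that \<open>d\<close>
  cannot be small on many elements. Three properties of \<open>d\<close> give this.

  It behaves like a length: it is even and subadditive. It is extremal on the nonzero elements of
  \<open>m Z_q\<close>: such a translation keeps every residue modulo \<open>m\<close>, and \<open>A\<close> has only one element with
  each residue, so \<open>d = m\<close> there. Hence the ball \<open>P_j = {x. d(x) \<le> j}\<close> has at most one element in
  each residue class modulo \<open>m\<close> as long as \<open>2 j < m\<close>: the difference of two of them would have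
  displacement at most \<open>2 j\<close>. Finally, if a sumset \<open>X + Y\<close> meets no residue class twice, then
  \<open>|X + Y| \<ge> |X| + |Y| - 1\<close> (\<open>card_sumset_mod_ge\<close>). The condition on the exponents in \<open>q\<close> enters
  here: it makes every nontrivial subgroup of \<open>Z_q\<close> meet \<open>m Z_q\<close> nontrivially, so that such a
  sumset has no periods, and Dyson's transform proves the inequality as in the Cauchy-Davenport
  theorem.

  Since \<open>P_i + P_j \<subseteq> P_(i+j)\<close>, this yields \<open>|P_i| + |P_j| \<le> |P_(i+j)| + 1\<close> for \<open>2 (i + j) < m\<close>.
  With \<open>J\<close> the largest integer such that \<open>2 J < m\<close>, one has \<open>|P_J| \<le> 2 J + 1\<close>; pairing \<open>P_j\<close> with
  \<open>P_(J-j)\<close> bounds the sum of the \<open>|P_j|\<close> over \<open>j \<le> J\<close> by \<open>(J + 1)^2\<close>. At least \<open>m - |P_j|\<close>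
  elements of \<open>A\<close> have displacement greater than \<open>j\<close>, so the number of carries is at least
  \<open>(J + 1) m - (J + 1)^2\<close>, which is the integer part of \<open>m^2 / 4\<close>.

  So \<open>C_2(A)\<close> is at least \<open>(1 - 1 / m^2) / 4\<close> for odd \<open>m\<close> and at least \<open>1 / 4\<close> for even \<open>m\<close>. This is
  at least \<open>\<mu>(m)\<close> because \<open>p^\<alpha>\<close> divides \<open>m\<close>. For the limit it remains to exhibit digital sets with
  \<open>C_2 \<le> 1 / 4\<close>: in an interval of \<open>m\<close> consecutive residues the element \<open>1\<close> has displacement at
  most \<open>1\<close>, so \<open>i\<close> has displacement at most \<open>|i|\<close>, and for an interval centred at \<open>0\<close> these
  numbers add up to at most \<open>m^2 / 4\<close>.
\<close>

section \<open>Arithmetic of admissible moduli\<close>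

text \<open>The exponent of \<open>p\<close> in \<open>q\<close> exceeds that in \<open>m\<close>, so one factor \<open>p\<close> can be spared. The element
  \<open>q / p\<close> generates the subgroup of order \<open>p\<close> of \<open>Z_q\<close>, so all minimal subgroups lie in
  \<open>m Z_q\<close>.\<close>

lemma admissible_dvd_div_prime:
  assumes "admissible_modulus m q" "m > 0" "prime p" "p dvd q"
  shows "m dvd q div p"
proof (rule multiplicity_le_imp_dvd)
  show "m \<noteq> 0" using assms(2) by simp
next
  fix r :: nat assume r: "prime r"
  have q: "q > 0" "prime_factors q = prime_factors m"
    and lt: "\<And>r. r \<in> prime_factors m \<Longrightarrow> multiplicity r m < multiplicity r q"
    using assms(1) by (auto simp: admissible_modulus_def)
  obtain k where k: "q = p * k" using assms(4) by (elim dvdE)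
  have pk: "p > 0" "k > 0" "q div p = k" using k q(1) by auto
  have mult: "multiplicity r q = multiplicity r p + multiplicity r k"
    unfolding k using pk r by (intro prime_elem_multiplicity_mult_distrib) auto
  show "multiplicity r m \<le> multiplicity r (q div p)"
  proof (cases "r dvd m")
    case True
    then have "r \<in> prime_factors m" using r assms(2) by (simp add: in_prime_factors_iff)
    moreover have "multiplicity r p \<le> 1"
      using r assms(3) by (cases "r = p") (auto simp: prime_multiplicity_other multiplicity_self)
    ultimately show ?thesis using lt[of r] mult pk by simp
  next
    case False
    then show ?thesis by (simp add: not_dvd_imp_multiplicity_0)
  qed
qed

lemma admissible_dvd:
  assumes "admissible_modulus m q" "m \<ge> 2"
  shows "m dvd q"
proof -
  obtain p where p: "prime p" "p dvd m" using assms(2) prime_factor_nat[of m] by auto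
  then have "p \<in> prime_factors q"
    using assms by (auto simp: admissible_modulus_def in_prime_factors_iff)
  then have pq: "p dvd q" by (simp add: in_prime_factors_iff)
  have "m dvd q div p" by (rule admissible_dvd_div_prime) (use assms p pq in auto)
  also have "q div p dvd q" using pq by (metis dvd_div_mult_self dvd_triv_left)
  finally show ?thesis .
qed

text \<open>The nontrivial subgroup of \<open>Z_q\<close> generated by \<open>d\<close> contains one of prime order, and the
  elements of that one are multiples of \<open>m\<close>.\<close>

lemma subgroup_meets_multiples:
  fixes d :: int
  assumes "admissible_modulus m q" "m > 0" "\<not> int q dvd d"
  obtains k :: nat where "int m dvd int k * d" "\<not> int q dvd int k * d"
proof -
  have q: "q > 0" using assms(1) by (simp add: admissible_modulus_def)
  define g where "g = gcd d (int q)"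
  have g: "g > 0" using q by (simp add: g_def)
  obtain d' e where de: "d = g * d'" "int q = g * e" "coprime d' e"
    using gcd_coprime_exists[of d "int q"] g unfolding g_def by (auto simp: mult.commute)
  have e: "e > 0" using q de(2) g by (metis of_nat_0_less_iff zero_less_mult_pos)
  have "e \<noteq> 1" using assms(3) de by auto
  then have "nat e \<noteq> 1" by (metis e int_nat_eq less_imp_le of_nat_1)
  then obtain p where p: "prime p" "p dvd nat e" using prime_factor_nat by blast
  have pe: "int p dvd e" using p(2) e by (metis int_dvd_int_iff int_nat_eq less_imp_le)
  \<comment> \<open>\<open>e\<close> is the order of \<open>d\<close> in \<open>Z_q\<close>, so \<open>f * d\<close> has order \<open>p\<close>.\<close>
  obtain f where f: "e = int p * f" using pe by (elim dvdE)
  have p0: "p > 0" using p(1) by (rule prime_gt_0_nat)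
  have f0: "f > 0" using e f p0 by (simp add: zero_less_mult_iff)
  have qf: "int q = int p * (g * f)" using de(2) f by simp
  have "p dvd q" using qf by (metis dvd_triv_left int_dvd_int_iff)
  have "q div p = nat (g * f)" 
    using qf p0 by (metis nat_int nonzero_mult_div_cancel_left of_nat_0_eq_iff of_nat_div less_numeral_extra(3))
  moreover have "m dvd q div p"
    by (rule admissible_dvd_div_prime) (use assms p \<open>p dvd q\<close> in auto)
  ultimately have m: "int m dvd g * f"
    using g f0 by (metis int_dvd_int_iff int_nat_eq mult_nonneg_nonneg less_imp_le)
  show ?thesis
  proof (rule that[of "nat f"])
    show "int m dvd int (nat f) * d" using m f0 de(1) by (simp add: mult_ac dvd_mult2 dvd_mult)
    show "\<not> int q dvd int (nat f) * d"
    proof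
      assume "int q dvd int (nat f) * d"
      then have "(g * f) * int p dvd (g * f) * d'" using f0 de(1) qf by (simp add: mult_ac)
      then have "int p dvd d'" using g f0 by simp
      then have "int p dvd 1" using pe de(3) by (meson coprime_common_divisor)
      then have "p = 1" by simp
      then show False using p(1) by simp
    qed
  qed
qed

section \<open>Sums of sets without two elements in one coset\<close>

definition sumset_mod :: "nat \<Rightarrow> int set \<Rightarrow> int set \<Rightarrow> int set" where
  "sumset_mod q X Y = (\<lambda>(x, y). (x + y) mod int q) ` (X \<times> Y)"

lemma sumset_modI: "x \<in> X \<Longrightarrow> y \<in> Y \<Longrightarrow> (x + y) mod int q \<in> sumset_mod q X Y"
  by (auto simp: sumset_mod_def)

lemma sumset_mod_subsetI:
  "(\<And>x y. x \<in> X \<Longrightarrow> y \<in> Y \<Longrightarrow> (x + y) mod int q \<in> S) \<Longrightarrow> sumset_mod q X Y \<subseteq> S"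
  by (auto simp: sumset_mod_def)

lemma inj_on_add_mod: "inj_on (\<lambda>y. (y + e) mod int q) {0..<int q}"
proof (rule inj_onI)
  fix x y :: int
  assume x: "x \<in> {0..<int q}" and y: "y \<in> {0..<int q}" and "(x + e) mod int q = (y + e) mod int q"
  then have "(x + e - e) mod int q = (y + e - e) mod int q" by (metis mod_diff_left_eq)
  then show "x = y" using x y by simp
qed

text \<open>Dyson's transform replaces \<open>X\<close> by \<open>X \<union> (Y + e)\<close> and \<open>Y\<close> by \<open>Y \<inter> (X - e)\<close>. It keeps
  \<open>|X| + |Y|\<close> and only shrinks the sumset, so injectivity modulo \<open>m\<close> is inherited and induction on
  \<open>|Y|\<close> applies whenever some \<open>e \<in> X - Y\<close> makes \<open>Y\<close> smaller. If none does, \<open>X\<close> is invariant under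
  all differences of elements of \<open>Y\<close>. A nonzero difference would make \<open>X\<close>, and so the sumset,
  invariant under a nonzero element of \<open>m Z_q\<close>, which injectivity forbids; hence \<open>Y\<close> is a single
  point.\<close>

lemma card_sumset_mod_ge:
  assumes adm: "admissible_modulus m q" and m: "m \<ge> 2"
    and "X \<subseteq> {0..<int q}" "Y \<subseteq> {0..<int q}" "X \<noteq> {}" "Y \<noteq> {}"
    and "inj_on (\<lambda>s. s mod int m) (sumset_mod q X Y)"
  shows "card X + card Y \<le> card (sumset_mod q X Y) + 1"
  using assms(3-)
proof (induction "card Y" arbitrary: X Y rule: less_induct)
  case less
  note X = less.prems(1) and Y = less.prems(2) and inj = less.prems(5)
  have fin: "finite X" "finite Y" using X Y finite_subset by blast+
  have finS: "finite (sumset_mod q X Y)" using fin by (simp add: sumset_mod_def)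
  have q: "q > 0" using adm by (simp add: admissible_modulus_def)
  have mq: "int m dvd int q" using admissible_dvd[OF adm m] by simp
  show ?case
  proof (cases "\<forall>x\<in>X. \<forall>y\<in>Y. \<forall>y'\<in>Y. (y' + (x - y)) mod int q \<in> X")
    case stable: True
    have "card Y \<le> 1"
    proof (rule ccontr)
      assume "\<not> card Y \<le> 1"
      then obtain y y' where y: "y \<in> Y" "y' \<in> Y" "y \<noteq> y'"
        using card_le_Suc0_iff_eq[OF fin(2)] by auto
      obtain x where x: "x \<in> X" using less.prems(3) by blast
      define d where "d = y' - y"
      have "\<not> int q dvd d"
      proof
        assume "int q dvd d"
        then have "y' mod int q = y mod int q" by (simp add: d_def mod_eq_dvd_iff)
        then show False using y Y by (simp add: subset_iff)
      qed
      then obtain k where k: "int m dvd int k * d" "\<not> int q dvd int k * d"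
        using subgroup_meets_multiples[OF adm] m by auto
      \<comment> \<open>\<open>X\<close> is invariant under translation by \<open>d\<close>, hence by the multiple \<open>k * d\<close> in \<open>m Z_q\<close>.\<close>
      have orbit: "(x + int n * d) mod int q \<in> X" for n
      proof (induction n)
        case 0
        show ?case using x X by (simp add: subset_iff)
      next
        case (Suc n)
        then have "(y' + ((x + int n * d) mod int q - y)) mod int q \<in> X" using stable y by blast
        also have "(y' + ((x + int n * d) mod int q - y)) mod int q
            = (d + (x + int n * d) mod int q) mod int q"
          by (simp add: d_def algebra_simps)
        also have "\<dots> = (x + int (Suc n) * d) mod int q" by (simp add: mod_simps algebra_simps)
        finally show ?case .
      qed
      define s1 s2 where "s1 = (x + y) mod int q" and "s2 = (x + int k * d + y) mod int q"
      have s1: "s1 \<in> sumset_mod q X Y" unfolding s1_def using x y(1) by (rule sumset_modI)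
      have s2: "s2 \<in> sumset_mod q X Y"
        using sumset_modI[OF orbit[of k] y(1), of q] by (simp add: s2_def mod_simps)
      have "s1 mod int m = (x + y) mod int m" "s2 mod int m = (x + int k * d + y) mod int m"
        using mq by (simp_all add: s1_def s2_def mod_mod_cancel)
      moreover have "(x + int k * d + y) mod int m = (x + y) mod int m"
        using k(1) by (simp add: mod_eq_dvd_iff)
      ultimately have "s1 = s2" using inj s1 s2 by (metis inj_onD)
      then have "int q dvd (x + int k * d + y) - (x + y)"
        unfolding s1_def s2_def by (metis mod_eq_dvd_iff)
      then show False using k(2) by simp
    qed
    moreover have "card X \<le> card (sumset_mod q X Y)"
    proof -
      obtain y where y: "y \<in> Y" using less.prems(4) by blast
      have "card X = card ((\<lambda>x. (x + y) mod int q) ` X)"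
        by (rule card_image[symmetric]) (rule inj_on_subset[OF inj_on_add_mod X])
      also have "\<dots> \<le> card (sumset_mod q X Y)"
        by (rule card_mono[OF finS]) (use y sumset_modI in blast)
      finally show ?thesis .
    qed
    ultimately show ?thesis by linarith
  next
    case False
    then obtain x y y' where xy: "x \<in> X" "y \<in> Y" "y' \<in> Y" "(y' + (x - y)) mod int q \<notin> X"
      by blast
    define e where "e = x - y"
    define T where "T = (\<lambda>y. (y + e) mod int q) ` Y"
    define X' where "X' = X \<union> T"
    define Y' where "Y' = {z \<in> Y. (z + e) mod int q \<in> X}"
    have injT: "inj_on (\<lambda>y. (y + e) mod int q) Y" by (rule inj_on_subset[OF inj_on_add_mod Y])
    have "card T = card Y" unfolding T_def by (rule card_image[OF injT])
    moreover have "card (X \<inter> T) = card Y'"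
    proof -
      have "X \<inter> T = (\<lambda>y. (y + e) mod int q) ` Y'" by (auto simp: T_def Y'_def)
      then show ?thesis by (simp add: card_image inj_on_subset[OF injT] Y'_def)
    qed
    moreover have "finite T" by (simp add: T_def fin)
    ultimately have cards: "card X' + card Y' = card X + card Y"
      using card_Un_Int[OF fin(1), of T] by (simp add: X'_def)
    have sub: "sumset_mod q X' Y' \<subseteq> sumset_mod q X Y"
    proof (rule sumset_mod_subsetI)
      fix u v assume u: "u \<in> X'" and v: "v \<in> Y'"
      show "(u + v) mod int q \<in> sumset_mod q X Y"
      proof (cases "u \<in> X")
        case True
        then show ?thesis using v by (simp add: sumset_modI Y'_def)
      next
        case False
        then obtain z where z: "z \<in> Y" "u = (z + e) mod int q" using u by (auto simp: X'_def T_def)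
        \<comment> \<open>The shift \<open>e\<close> moves from one summand to the other: \<open>(z + e) + v = (v + e) + z\<close>.\<close>
        have "((v + e) mod int q + z) mod int q \<in> sumset_mod q X Y"
          using v z by (intro sumset_modI) (auto simp: Y'_def)
        also have "((v + e) mod int q + z) mod int q = (u + v) mod int q"
          by (simp add: z(2) mod_simps algebra_simps)
        finally show ?thesis .
      qed
    qed
    have "Y' \<subset> Y" using xy by (auto simp: Y'_def e_def)
    then have lt: "card Y' < card Y" using fin(2) by (rule psubset_card_mono[rotated])
    have "x mod int q = x" using xy(1) X by (simp add: subset_iff)
    then have "y \<in> Y'" using xy by (simp add: Y'_def e_def)
    moreover have "X' \<subseteq> {0..<int q}" using X q by (auto simp: X'_def T_def)
    moreover have "Y' \<subseteq> {0..<int q}" using Y by (auto simp: Y'_def)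
    moreover have "X' \<noteq> {}" using xy(1) by (auto simp: X'_def)
    ultimately have "card X' + card Y' \<le> card (sumset_mod q X' Y') + 1"
      by (intro less.hyps[OF lt] inj_on_subset[OF inj sub]) auto
    also have "card (sumset_mod q X' Y') \<le> card (sumset_mod q X Y)" by (rule card_mono[OF finS sub])
    finally show ?thesis using cards by simp
  qed
qed

section \<open>The displacement of a set under translation\<close>

definition displacement :: "nat \<Rightarrow> int set \<Rightarrow> int \<Rightarrow> nat" where
  "displacement q A x = card {a \<in> A. (x + a) mod int q \<notin> A}"

lemma displacement_mod [simp]: "displacement q A (x mod int q) = displacement q A x"
  by (simp add: displacement_def mod_simps)

text \<open>If \<open>a\<close> leaves \<open>A\<close> under \<open>x + y\<close>, then either \<open>a\<close> already leaves \<open>A\<close> under \<open>y\<close>, or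
  \<open>y + a\<close> is an element of \<open>A\<close> that leaves \<open>A\<close> under \<open>x\<close>.\<close>

lemma displacement_add_le:
  assumes "A \<subseteq> {0..<int q}"
  shows "displacement q A (x + y) \<le> displacement q A x + displacement q A y"
proof -
  have fin: "finite A" using assms finite_subset by blast
  define B where "B = {a \<in> A. (y + a) mod int q \<in> A \<and> (x + (y + a)) mod int q \<notin> A}"
  have "displacement q A (x + y) \<le> card (B \<union> {a \<in> A. (y + a) mod int q \<notin> A})"
    unfolding displacement_def by (rule card_mono) (use fin in \<open>auto simp: B_def add.assoc\<close>)
  also have "\<dots> \<le> card B + displacement q A y"
    unfolding displacement_def by (rule card_Un_le)
  also have "card B \<le> displacement q A x"
    unfolding displacement_def
  proof (rule card_inj_on_le)
    show "inj_on (\<lambda>a. (a + y) mod int q) B"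
      by (rule inj_on_subset[OF inj_on_add_mod]) (use assms in \<open>auto simp: B_def\<close>)
    show "(\<lambda>a. (a + y) mod int q) ` B \<subseteq> {a \<in> A. (x + a) mod int q \<notin> A}"
      by (auto simp: B_def mod_simps add_ac)
  qed (use fin in simp)
  finally show ?thesis by simp
qed

text \<open>Translation by \<open>x\<close> matches the elements that stay in \<open>A\<close> under \<open>x\<close> with those that stay
  in \<open>A\<close> under \<open>- x\<close>.\<close>

lemma displacement_minus:
  assumes "A \<subseteq> {0..<int q}"
  shows "displacement q A (- x) = displacement q A x"
proof -
  have fin: "finite A" using assms finite_subset by blast
  define S where "S z = {a \<in> A. (z + a) mod int q \<in> A}" for z
  have le: "card (S z) \<le> card (S (- z))" for z
  proof (rule card_inj_on_le)
    show "inj_on (\<lambda>a. (a + z) mod int q) (S z)"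
      by (rule inj_on_subset[OF inj_on_add_mod]) (use assms in \<open>auto simp: S_def\<close>)
    show "(\<lambda>a. (a + z) mod int q) ` S z \<subseteq> S (- z)"
      using assms by (auto simp: S_def mod_simps add_ac subset_iff)
  qed (use fin in \<open>simp add: S_def\<close>)
  have compl: "displacement q A z = card A - card (S z)" for z
  proof -
    have "{a \<in> A. (z + a) mod int q \<notin> A} = A - S z" by (auto simp: S_def)
    then show ?thesis using fin by (simp add: displacement_def card_Diff_subset S_def)
  qed
  show ?thesis using le[of x] le[of "- x"] by (simp add: compl)
qed

lemma displacement_zero:
  assumes "A \<subseteq> {0..<int q}"
  shows "displacement q A 0 = 0"
proof -
  have "{a \<in> A. (0 + a) mod int q \<notin> A} = {}" using assms by (auto simp: subset_iff)
  then show ?thesis by (simp only: displacement_def card.empty)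
qed

text \<open>A translation by a nonzero element of \<open>m Z_q\<close> moves each \<open>a \<in> A\<close> to a different element of the
  same class modulo \<open>m\<close>, where \<open>A\<close> has no second element.\<close>

lemma displacement_multiple:
  assumes "A \<subseteq> {0..<int q}" "inj_on (\<lambda>a. a mod int m) A" "m dvd q"
    and "int m dvd x" "\<not> int q dvd x"
  shows "displacement q A x = card A"
proof -
  have "(x + a) mod int q \<notin> A" if "a \<in> A" for a
  proof
    assume *: "(x + a) mod int q \<in> A"
    have "(x + a) mod int q mod int m = (x + a) mod int m" using assms(3) by (simp add: mod_mod_cancel)
    also have "\<dots> = a mod int m" using assms(4) by (simp add: mod_eq_dvd_iff)
    finally have "(x + a) mod int q = a" using assms(2) * that by (metis inj_onD)
    then have "(x + a) mod int q = a mod int q" by (metis mod_mod_trivial)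
    then show False using assms(5) by (simp add: mod_eq_dvd_iff)
  qed
  then have "{a \<in> A. (x + a) mod int q \<notin> A} = A" by blast
  then show ?thesis by (simp add: displacement_def)
qed

lemma carry_freq_eq_sum_displacement:
  assumes "A \<subseteq> {0..<int q}"
  shows "carry_freq q A = real (\<Sum>a\<in>A. displacement q A a) / (real (card A))\<^sup>2"
proof -
  have fin: "finite A" using assms finite_subset by blast
  have "{(a1, a2). a1 \<in> A \<and> a2 \<in> A \<and> a1 \<oplus>\<^bsub>Zmod q\<^esub> a2 \<notin> A}
      = (SIGMA a:A. {b \<in> A. (a + b) mod int q \<notin> A})"
    by (auto simp: residue_ring_def)
  then show ?thesis using fin by (simp add: carry_freq_def displacement_def)
qed

section \<open>The lower bound\<close>

definition displacement_ball :: "nat \<Rightarrow> int set \<Rightarrow> nat \<Rightarrow> int set" where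
  "displacement_ball q A j = {x \<in> {0..<int q}. displacement q A x \<le> j}"

lemma finite_displacement_ball [simp]: "finite (displacement_ball q A j)"
  unfolding displacement_ball_def by (rule finite_subset[of _ "{0..<int q}"]) auto

text \<open>Two congruent elements of the ball differ by an element of \<open>m Z_q\<close> of displacement at most
  \<open>2 j < |A|\<close>, so this difference is zero.\<close>

lemma inj_on_displacement_ball:
  assumes A: "A \<subseteq> {0..<int q}" "inj_on (\<lambda>a. a mod int m) A" "m dvd q" and j: "2 * j < card A"
  shows "inj_on (\<lambda>x. x mod int m) (displacement_ball q A j)"
proof (rule inj_onI, rule ccontr)
  fix x y
  assume x: "x \<in> displacement_ball q A j" and y: "y \<in> displacement_ball q A j"
    and eq: "x mod int m = y mod int m" and ne: "x \<noteq> y"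
  have "int m dvd x - y" using eq by (simp add: mod_eq_dvd_iff)
  moreover have "\<not> int q dvd x - y"
    using x y ne by (auto simp: displacement_ball_def simp flip: mod_eq_dvd_iff)
  ultimately have "card A = displacement q A (x + - y)"
    using displacement_multiple[OF A, of "x - y"] by simp
  also have "\<dots> \<le> displacement q A x + displacement q A (- y)" by (rule displacement_add_le[OF A(1)])
  also have "\<dots> \<le> j + j"
    using x y by (intro add_mono) (auto simp: displacement_ball_def displacement_minus[OF A(1)])
  finally show False using j by simp
qed

text \<open>Balls grow at least linearly: the sumset of the balls of radii \<open>i\<close> and \<open>j\<close> lies in the ball of
  radius \<open>i + j\<close>, on which reduction modulo \<open>m\<close> is still injective.\<close>

lemma card_displacement_ball_add:
  assumes adm: "admissible_modulus m q" "m \<ge> 2"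
    and A: "A \<subseteq> {0..<int q}" "inj_on (\<lambda>a. a mod int m) A" and ij: "2 * (i + j) < card A"
  shows "card (displacement_ball q A i) + card (displacement_ball q A j)
         \<le> card (displacement_ball q A (i + j)) + 1"
proof -
  have q: "q > 0" using adm by (simp add: admissible_modulus_def)
  let ?P = "displacement_ball q A"
  have zero: "0 \<in> ?P n" for n using q by (simp add: displacement_ball_def displacement_zero[OF A(1)])
  have sub: "sumset_mod q (?P i) (?P j) \<subseteq> ?P (i + j)"
  proof (rule sumset_mod_subsetI)
    fix x y assume "x \<in> ?P i" "y \<in> ?P j"
    then have "displacement q A x + displacement q A y \<le> i + j" by (simp add: displacement_ball_def)
    then have "displacement q A (x + y) \<le> i + j"
      using displacement_add_le[OF A(1), of x y] by linarith
    then show "(x + y) mod int q \<in> ?P (i + j)" using q by (simp add: displacement_ball_def)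
  qed
  have "card (?P i) + card (?P j) \<le> card (sumset_mod q (?P i) (?P j)) + 1"
  proof (rule card_sumset_mod_ge[OF adm])
    show "inj_on (\<lambda>s. s mod int m) (sumset_mod q (?P i) (?P j))"
      by (rule inj_on_subset[OF inj_on_displacement_ball[OF A admissible_dvd[OF adm] ij] sub])
    show "?P i \<noteq> {}" "?P j \<noteq> {}" using zero by blast+
  qed (auto simp: displacement_ball_def)
  also have "card (sumset_mod q (?P i) (?P j)) \<le> card (?P (i + j))"
    by (rule card_mono[OF _ sub]) simp
  finally show ?thesis by simp
qed

text \<open>For odd \<open>m\<close> the bound is the number of residues modulo \<open>m\<close>. For even \<open>m\<close> it is one less, because
  the class of \<open>m / 2\<close> is missed: the ball is symmetric and this class is its own negative, so an
  element \<open>x\<close> of the ball in it would equal \<open>- x\<close>. But \<open>2 x = 0\<close> in \<open>Z_q\<close> forces \<open>x \<in> m Z_q\<close>, as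
  the exponent of \<open>2\<close> in \<open>q\<close> exceeds that in \<open>m\<close>. Without this saving the final bound for even
  \<open>m\<close> would be \<open>m (m - 1) / 4\<close> instead of \<open>m^2 / 4\<close>.\<close>

lemma card_displacement_ball_half:
  assumes adm: "admissible_modulus m q" "m \<ge> 2"
    and A: "A \<subseteq> {0..<int q}" "inj_on (\<lambda>a. a mod int m) A" "card A = m"
  shows "card (displacement_ball q A ((m - 1) div 2)) \<le> 2 * ((m - 1) div 2) + 1"
proof -
  define J where "J = (m - 1) div 2"
  let ?P = "displacement_ball q A J"
  have J: "2 * J < card A" using A(3) adm(2) unfolding J_def by linarith
  have q: "q > 0" using adm by (simp add: admissible_modulus_def)
  have mq: "m dvd q" by (rule admissible_dvd[OF adm])
  have inj: "inj_on (\<lambda>x. x mod int m) ?P"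
    by (rule inj_on_displacement_ball[OF A(1,2) mq J])
  have img: "(\<lambda>x. x mod int m) ` ?P \<subseteq> {0..<int m}" using adm(2) by auto
  show ?thesis
  proof (cases "odd m")
    case True
    have "card ?P \<le> card {0..<int m}" by (rule card_inj_on_le[OF inj img]) simp
    also have "\<dots> = 2 * J + 1" using True by (auto simp: J_def elim!: oddE)
    finally show ?thesis by (simp add: J_def)
  next
    case False
    then obtain h where h: "m = 2 * h" by auto
    have no: "x mod int m \<noteq> int h" if x: "x \<in> ?P" for x
    proof
      assume eq: "x mod int m = int h"
      define y where "y = (- x) mod int q"
      have y: "y \<in> ?P"
        using x q by (simp add: y_def displacement_ball_def displacement_minus[OF A(1)])
      have "y mod int m = (- x) mod int m" using mq by (simp add: y_def mod_mod_cancel)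
      also have "\<dots> = (- (x mod int m)) mod int m" by (simp add: mod_simps)
      also have "\<dots> = (- int h) mod int m" by (simp add: eq)
      also have "\<dots> = int h mod int m"
      proof -
        have "- int h - int h = int m * (- 1)" by (simp add: h)
        then show ?thesis by (metis dvd_triv_left mod_eq_dvd_iff)
      qed
      also have "\<dots> = x mod int m" using eq by (metis mod_mod_trivial)
      finally have "y = x" using inj x y by (metis inj_onD)
      then have "(- x) mod int q = x mod int q" by (metis y_def mod_mod_trivial)
      then have "int q dvd 2 * x" by (metis diff_minus_eq_add mod_eq_dvd_iff mult_2)
      moreover have "2 dvd q" using h mq by (metis dvd_mult_left)
      moreover from this obtain k where k: "q = 2 * k" by (elim dvdE)
      ultimately have "int k dvd x" by simp
      moreover have "m dvd k"
        using admissible_dvd_div_prime[OF adm(1), of 2] adm(2) \<open>2 dvd q\<close> k by simp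
      ultimately have "int m dvd x" by (meson dvd_trans int_dvd_int_iff)
      then show False using eq adm(2) h by simp
    qed
    have "card ?P \<le> card ({0..<int m} - {int h})"
      by (rule card_inj_on_le[OF inj]) (use img no in auto)
    also have "\<dots> = m - 1" using h adm(2) by simp
    finally show ?thesis using h adm(2) by (simp add: J_def)
  qed
qed

text \<open>The sum counts the pairs \<open>(a, j)\<close> with \<open>j < d(a)\<close>; only those with \<open>j \<le> J\<close> are kept. For a fixed
  \<open>j\<close> at most \<open>|P_j|\<close> elements of \<open>A\<close> are lost, and superadditivity of \<open>|P_j| - 1\<close> bounds these
  losses on average over \<open>j\<close> and \<open>J - j\<close>.\<close>

lemma sum_displacement_ge:
  assumes adm: "admissible_modulus m q" "m \<ge> 2"
    and A: "A \<subseteq> {0..<int q}" "inj_on (\<lambda>a. a mod int m) A" "card A = m"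
  shows "m\<^sup>2 div 4 \<le> (\<Sum>a\<in>A. displacement q A a)"
proof -
  define J where "J = (m - 1) div 2"
  define c where "c j = card (displacement_ball q A j)" for j
  have fin: "finite A" using A(1) finite_subset by blast
  have cJ: "c J \<le> 2 * J + 1" unfolding c_def J_def by (rule card_displacement_ball_half[OF assms])
  have "2 * (\<Sum>j\<le>J. c j) = (\<Sum>j\<le>J. c j) + (\<Sum>j\<le>J. c (J - j))"
    using sum.nat_diff_reindex[of c "Suc J"] by (simp add: lessThan_Suc_atMost)
  also have "\<dots> = (\<Sum>j\<le>J. c j + c (J - j))" by (simp add: sum.distrib)
  also have "\<dots> \<le> (\<Sum>j\<le>J. 2 * J + 2)"
  proof (rule sum_mono)
    fix j assume "j \<in> {..J}"
    moreover have "2 * J < card A" using A(3) adm(2) unfolding J_def by linarith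
    ultimately have "c j + c (J - j) \<le> c J + 1"
      using card_displacement_ball_add[OF adm A(1,2), of j "J - j"] by (simp add: c_def)
    then show "c j + c (J - j) \<le> 2 * J + 2" using cJ by simp
  qed
  finally have balls: "(\<Sum>j\<le>J. c j) \<le> (J + 1) * (J + 1)" by simp
  have "(\<Sum>j\<le>J. m) \<le> (\<Sum>j\<le>J. c j + card {a \<in> A. j < displacement q A a})"
  proof (rule sum_mono)
    fix j
    have "A \<subseteq> displacement_ball q A j \<union> {a \<in> A. j < displacement q A a}"
      using A(1) by (auto simp: displacement_ball_def)
    then have "card A \<le> card (displacement_ball q A j \<union> {a \<in> A. j < displacement q A a})"
      by (rule card_mono[rotated]) (simp add: fin)
    also have "\<dots> \<le> c j + card {a \<in> A. j < displacement q A a}" unfolding c_def by (rule card_Un_le)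
    finally show "m \<le> c j + card {a \<in> A. j < displacement q A a}" by (simp add: A(3))
  qed
  then have "(J + 1) * m \<le> (\<Sum>j\<le>J. c j) + (\<Sum>j\<le>J. card {a \<in> A. j < displacement q A a})"
    by (simp add: sum.distrib)
  also have "(\<Sum>j\<le>J. card {a \<in> A. j < displacement q A a})
      = (\<Sum>j\<le>J. \<Sum>a\<in>A. of_bool (j < displacement q A a))"
    using fin by (simp add: Int_def conj_commute)
  also have "\<dots> = (\<Sum>a\<in>A. \<Sum>j\<le>J. of_bool (j < displacement q A a))" by (rule sum.swap)
  also have "\<dots> \<le> (\<Sum>a\<in>A. displacement q A a)"
  proof (rule sum_mono)
    fix a
    have "(\<Sum>j\<le>J. of_bool (j < displacement q A a)) = card ({..J} \<inter> {j. j < displacement q A a})"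
      by simp
    also have "\<dots> \<le> card {..<displacement q A a}" by (rule card_mono) auto
    finally show "(\<Sum>j\<le>J. of_bool (j < displacement q A a)) \<le> displacement q A a" by simp
  qed
  finally have main: "(J + 1) * m \<le> (J + 1) * (J + 1) + (\<Sum>a\<in>A. displacement q A a)"
    using balls by linarith
  show ?thesis
  proof (cases "odd m")
    case True
    then obtain h where h: "m = 2 * h + 1" by (elim oddE)
    then have "J = h" by (simp add: J_def)
    then have "h * h + h \<le> (\<Sum>a\<in>A. displacement q A a)" using main h by (simp add: algebra_simps)
    moreover have "m\<^sup>2 = 1 + 4 * (h * h + h)" by (simp add: h power2_eq_square algebra_simps)
    then have "m\<^sup>2 div 4 = h * h + h" by presburger
    ultimately show ?thesis by simp
  next
    case False
    then obtain h where h: "m = 2 * h" by auto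
    then have "J + 1 = h" using adm(2) by (simp add: J_def)
    then have "h * h \<le> (\<Sum>a\<in>A. displacement q A a)" using main h by (simp add: algebra_simps)
    moreover have "m\<^sup>2 = 4 * (h * h)" by (simp add: h power2_eq_square)
    then have "m\<^sup>2 div 4 = h * h" by simp
    ultimately show ?thesis by simp
  qed
qed

lemma carry_freq_ge:
  assumes adm: "admissible_modulus m q" "m \<ge> 2" and dig: "digital_set q m A"
  shows "(1 - of_bool (odd m) / (real m)\<^sup>2) / 4 \<le> carry_freq q A"
proof -
  have q: "q > 0" using adm by (simp add: admissible_modulus_def)
  have A: "A \<subseteq> {0..<int q}" "inj_on (\<lambda>a. a mod int m) A"
    using dig digital_set_iff_bij_betw[OF q admissible_dvd[OF adm]] by (auto simp: bij_betw_def)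
  have card: "card A = m" using dig by (simp add: digital_set_def)
  define N where "N = (\<Sum>a\<in>A. displacement q A a)"
  have "m\<^sup>2 div 4 \<le> N" unfolding N_def by (rule sum_displacement_ge[OF adm A card])
  moreover have "m\<^sup>2 mod 4 = of_bool (odd m)"
  proof (cases "odd m")
    case True
    then obtain h where "m = 2 * h + 1" by (elim oddE)
    then have "m\<^sup>2 = 1 + 4 * (h * h + h)" by (simp add: power2_eq_square algebra_simps)
    then have "m\<^sup>2 mod 4 = 1" by presburger
    then show ?thesis using True by simp
  next
    case False
    then obtain h where "m = 2 * h" by auto
    then have "m\<^sup>2 = 4 * (h * h)" by (simp add: power2_eq_square)
    then show ?thesis using False by simp
  qed
  moreover have "m\<^sup>2 = 4 * (m\<^sup>2 div 4) + m\<^sup>2 mod 4" by simp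
  ultimately have "m\<^sup>2 \<le> 4 * N + of_bool (odd m)" by (metis add_le_mono1 mult_le_mono2)
  then have "real (m\<^sup>2) \<le> real (4 * N + of_bool (odd m))" by (rule of_nat_mono)
  then have "(real m)\<^sup>2 \<le> 4 * real N + of_bool (odd m)" by simp
  then have N: "((real m)\<^sup>2 - of_bool (odd m)) / 4 \<le> real N" by (cases "odd m") simp_all
  have "(1 - of_bool (odd m) / (real m)\<^sup>2) / 4 = ((real m)\<^sup>2 - of_bool (odd m)) / 4 / (real m)\<^sup>2"
    using adm(2) by (simp add: field_simps)
  also have "\<dots> \<le> real N / (real m)\<^sup>2" by (rule divide_right_mono[OF N]) simp
  finally show ?thesis
    by (simp add: carry_freq_eq_sum_displacement[OF A(1)] card N_def)
qed

section \<open>The symmetric interval of digits\<close>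

lemma sum_abs_interval:
  "2 * (\<Sum>i\<in>{- int j..int k}. nat \<bar>i\<bar>) = j * (j + 1) + k * (k + 1)"
proof (induction k)
  case 0
  show ?case
  proof (induction j)
    case (Suc j)
    have "{- int (Suc j)..int 0} = insert (- int (Suc j)) {- int j..int 0}" by auto
    then show ?case using Suc by simp
  qed simp
next
  case (Suc k)
  have "{- int j..int (Suc k)} = insert (int (Suc k)) {- int j..int k}" by auto
  then show ?case using Suc by simp
qed

text \<open>The digits are the residues of the \<open>m\<close> consecutive integers nearest to \<open>0\<close>, in the group
  \<open>Z_q\<close> with \<open>q = m^2\<close>. Translation by \<open>1\<close> moves only the last digit out of the set, and
  subadditivity does the rest.\<close>

lemma min_carry_freq_le:
  assumes "m \<ge> 2"
  shows "min_carry_freq m \<le> 1 / 4"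
proof -
  define q where "q = m\<^sup>2"
  define j k where "j = (m - 1) div 2" and "k = m div 2"
  define I where "I = {- int j..int k}"
  define A where "A = (\<lambda>i. i mod int q) ` I"
  have jk: "j + k + 1 = m" using assms unfolding j_def k_def by linarith
  have adm: "admissible_modulus m q"
    using assms unfolding q_def
    by (auto simp: admissible_modulus_def prime_factors_power prime_elem_multiplicity_power_distrib
        prime_factors_multiplicity)
  have q: "q > 0" and mq: "m dvd q" using assms by (simp_all add: q_def)
  have A: "A \<subseteq> {0..<int q}" using q by (auto simp: A_def)
  have injm: "inj_on (\<lambda>i. i mod int m) I"
  proof (rule inj_onI)
    fix x y assume xy: "x \<in> I" "y \<in> I" and "x mod int m = y mod int m"
    then have "int m dvd x - y" by (simp add: mod_eq_dvd_iff)
    moreover have "\<bar>x - y\<bar> < int m" using xy jk by (auto simp: I_def)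
    ultimately show "x = y" using dvd_imp_le_int[of "x - y" "int m"] by fastforce
  qed
  have mod_mod: "i mod int q mod int m = i mod int m" for i using mq by (simp add: mod_mod_cancel)
  have injq: "inj_on (\<lambda>i. i mod int q) I" using injm by (metis (mono_tags, lifting) inj_on_def mod_mod)
  have cardI: "card I = m" using jk by (simp add: I_def)
  then have card: "card A = m" unfolding A_def using injq by (simp add: card_image)
  have "inj_on (\<lambda>a. a mod int m) A"
    using injm unfolding A_def by (auto simp: inj_on_def mod_mod)
  moreover have "(\<lambda>a. a mod int m) ` A = {0..<int m}"
    using assms calculation card by (intro card_subset_eq) (auto simp: card_image)
  ultimately have dig: "digital_set q m A"
    using A by (simp add: digital_set_iff_bij_betw[OF q mq] bij_betw_def)
  have "displacement q A 1 \<le> card {int k mod int q}"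
    unfolding displacement_def
  proof (rule card_mono)
    show "{a \<in> A. (1 + a) mod int q \<notin> A} \<subseteq> {int k mod int q}"
    proof
      fix a assume "a \<in> {a \<in> A. (1 + a) mod int q \<notin> A}"
      then obtain i where i: "i \<in> I" "a = i mod int q" "(1 + i) mod int q \<notin> A"
        by (auto simp: A_def mod_simps)
      then have "1 + i \<notin> I" by (auto simp: A_def)
      then have "i = int k" using i(1) by (auto simp: I_def)
      then show "a \<in> {int k mod int q}" by (simp add: i(2))
    qed
  qed simp
  then have one: "displacement q A 1 \<le> 1" by simp
  have nat_le: "displacement q A (int n) \<le> n" for n
  proof (induction n)
    case 0
    show ?case by (simp add: displacement_zero[OF A])
  next
    case (Suc n)
    then show ?case using displacement_add_le[OF A, of 1 "int n"] one by simp
  qed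
  have abs_le: "displacement q A i \<le> nat \<bar>i\<bar>" for i
    using nat_le[of "nat \<bar>i\<bar>"] displacement_minus[OF A, of i] by (cases "i \<ge> 0") auto
  have "(\<Sum>a\<in>A. displacement q A a) = (\<Sum>i\<in>I. displacement q A i)"
    unfolding A_def by (subst sum.reindex[OF injq]) (simp flip: A_def)
  also have "\<dots> \<le> (\<Sum>i\<in>I. nat \<bar>i\<bar>)" by (rule sum_mono) (rule abs_le)
  finally have "2 * (\<Sum>a\<in>A. displacement q A a) \<le> j * (j + 1) + k * (k + 1)"
    using sum_abs_interval[of j k] by (simp add: I_def)
  then have "2 * (2 * (\<Sum>a\<in>A. displacement q A a)) \<le> 2 * (j * (j + 1) + k * (k + 1))"
    by (rule mult_le_mono2)
  also have "2 * (j * (j + 1) + k * (k + 1)) \<le> m\<^sup>2"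
  proof (cases "odd m")
    case True
    then obtain h where "m = 2 * h + 1" by (elim oddE)
    then show ?thesis by (simp add: j_def k_def power2_eq_square algebra_simps)
  next
    case False
    then obtain h where h: "m = 2 * h" by auto
    then obtain l where "h = Suc l" using assms by (cases h) auto
    then have "j = l" "k = Suc l" "m = 2 * Suc l" using h by (simp_all add: j_def k_def)
    then show ?thesis by (simp add: power2_eq_square algebra_simps)
  qed
  finally have "4 * (\<Sum>a\<in>A. displacement q A a) \<le> m\<^sup>2" by simp
  then have "real (4 * (\<Sum>a\<in>A. displacement q A a)) \<le> real (m\<^sup>2)" by (rule of_nat_mono)
  then have "carry_freq q A \<le> 1 / 4"
    using assms unfolding carry_freq_eq_sum_displacement[OF A] card by (simp add: field_simps)
  moreover have "min_carry_freq m \<le> carry_freq q A"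
    unfolding min_carry_freq_def
    by (rule Min_le[OF finite_carry_freqs]) (use adm dig in \<open>auto simp: carry_freqs_def\<close>)
  ultimately show ?thesis by linarith
qed

section \<open>The bound in terms of the largest prime power, and the limit\<close>

lemma largest_primepow_dvd:
  assumes "m \<ge> (2::nat)"
  shows "Max {d. primepow d \<and> d dvd m} dvd m"
proof -
  obtain p where "prime p" "p dvd m" using assms prime_factor_nat[of m] by auto
  then have "p \<in> {d. primepow d \<and> d dvd m}" by (simp add: primepow_prime)
  moreover have "finite {d. primepow d \<and> d dvd m}"
    by (rule finite_subset[of _ "{d. d dvd m}"]) (use assms in auto)
  ultimately have "Max {d. primepow d \<and> d dvd m} \<in> {d. primepow d \<and> d dvd m}"
    by (intro Max_in) auto
  then show ?thesis by simp
qed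

theorem theorem1p1:
  shows "(\<forall>(q::nat) (m::nat) (A::int set) (p::nat) (\<alpha>::nat).
            m \<ge> 2 \<and> admissible_modulus m q \<and> digital_set q m A \<and>
            prime p \<and> \<alpha> \<ge> 1 \<and> p ^ \<alpha> = Max {d. primepow d \<and> d dvd m} \<longrightarrow>
            carry_freq q A \<ge>
              (if p = 2 then 1 / 4
               else (1 - 1 / real p ^ (2 * \<alpha>) - 2 / real p ^ \<alpha> + 2 * of_bool (odd m) / real m) / 4))
         \<and> min_carry_freq \<longlonglongrightarrow> 1 / 4"
proof (intro conjI allI impI)
  fix q m :: nat and A :: "int set" and p \<alpha> :: nat
  assume *: "m \<ge> 2 \<and> admissible_modulus m q \<and> digital_set q m A \<and>
            prime p \<and> \<alpha> \<ge> 1 \<and> p ^ \<alpha> = Max {d. primepow d \<and> d dvd m}"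
  then have m: "m \<ge> 2" and p: "prime p" and \<alpha>: "\<alpha> \<ge> 1" by auto
  have bound: "(1 - of_bool (odd m) / (real m)\<^sup>2) / 4 \<le> carry_freq q A"
    using * by (intro carry_freq_ge) auto
  have dvd: "p ^ \<alpha> dvd m" using * largest_primepow_dvd[OF m] by simp
  have p0: "p > 0" using p by (rule prime_gt_0_nat)
  define M where "M = real p ^ \<alpha>"
  have M: "M \<ge> 1" "M \<le> real m"
  proof -
    have "p ^ \<alpha> \<le> m" using dvd m by (intro dvd_imp_le) auto
    then show "M \<le> real m" unfolding M_def by (metis of_nat_le_iff of_nat_power)
    show "M \<ge> 1" unfolding M_def using p0 by (intro one_le_power) simp
  qed
  have M2: "real p ^ (2 * \<alpha>) = M\<^sup>2" by (simp add: M_def power_mult mult.commute)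
  show "carry_freq q A \<ge> (if p = 2 then 1 / 4
      else (1 - 1 / real p ^ (2 * \<alpha>) - 2 / real p ^ \<alpha> + 2 * of_bool (odd m) / real m) / 4)"
  proof (cases "p = 2")
    case True
    have "p dvd p ^ \<alpha>" using \<alpha> by simp
    then have "even m" using dvd True by (metis dvd_trans)
    then show ?thesis using bound True by simp
  next
    case False
    have le: "2 / real m \<le> 2 / M" "1 / (real m)\<^sup>2 \<le> 1 / M\<^sup>2"
      using M by (intro divide_left_mono power_mono mult_pos_pos zero_less_power; simp)+
    have nonneg: "0 \<le> 2 / M" "0 \<le> 1 / M\<^sup>2" using M by simp_all
    have "1 - 1 / M\<^sup>2 - 2 / M + 2 * of_bool (odd m) / real m \<le> 1 - of_bool (odd m) / (real m)\<^sup>2"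
    proof (cases "odd m")
      case True
      then show ?thesis using le by simp
    next
      case False
      have "1 - 1 / M\<^sup>2 - 2 / M \<le> 1" using nonneg by linarith
      then show ?thesis using False by simp
    qed
    then show ?thesis using bound False unfolding M2 M_def[symmetric] by simp
  qed
next
  have lower: "(1 - 1 / (real m)\<^sup>2) / 4 \<le> min_carry_freq m" if m: "m \<ge> 2" for m
  proof -
    have "min_carry_freq m \<in> carry_freqs m"
      unfolding min_carry_freq_def by (rule Min_in[OF finite_carry_freqs carry_freqs_nonempty[OF m]])
    then obtain q A where "min_carry_freq m = carry_freq q A" "admissible_modulus m q" "digital_set q m A"
      by (auto simp: carry_freqs_def)
    then have "(1 - of_bool (odd m) / (real m)\<^sup>2) / 4 \<le> min_carry_freq m"
      using carry_freq_ge[of m q A] m by simp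
    moreover have "of_bool (odd m) / (real m)\<^sup>2 \<le> 1 / (real m)\<^sup>2" by (intro divide_right_mono) auto
    ultimately show ?thesis by simp
  qed
  have "(\<lambda>m. 1 / real m) \<longlonglongrightarrow> 0" by (rule lim_1_over_n)
  then have "(\<lambda>m. (1 - (1 / real m)\<^sup>2) / 4) \<longlonglongrightarrow> (1 - 0\<^sup>2) / 4" by (intro tendsto_intros) auto
  then have lim: "(\<lambda>m. (1 - 1 / (real m)\<^sup>2) / 4) \<longlonglongrightarrow> 1 / 4" by (simp add: power_one_over)
  show "min_carry_freq \<longlonglongrightarrow> 1 / 4"
  proof (rule tendsto_sandwich[OF _ _ lim tendsto_const])
    show "\<forall>\<^sub>F m in sequentially. (1 - 1 / (real m)\<^sup>2) / 4 \<le> min_carry_freq m"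
      using eventually_ge_at_top[of 2] by eventually_elim (rule lower)
    show "\<forall>\<^sub>F m in sequentially. min_carry_freq m \<le> 1 / 4"
      using eventually_ge_at_top[of 2] by eventually_elim (rule min_carry_freq_le)
  qed
qed

end
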